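(* Let $\Lambda_4\subset\mathbb{R}^4$ be the lattice generated by $2\varepsilon_1,2\varepsilon_2,2\varepsilon_3,\varepsilon_1+\varepsilon_2+\varepsilon_3+\varepsilon_4$. Every integral lattice $M\subset\mathbb{R}^4$ with $\Lambda_4\subseteq M$ is isometric to one of the six lattices $\Lambda_4$, $\Lambda_4(\varepsilon_1)$, $\Lambda_4(\varepsilon_1,\varepsilon_2)$, $(\bm{A}_1)^4$, $\bm{D}_4$, $\mathbb{Z}^4$.
   Context: $\varepsilon_1,\dots,\varepsilon_4$ is the standard orthonormal basis of $\mathbb{R}^4$. A lattice is integral if all inner products of its vectors are integers. $L(x_1,\dots,x_k)$ denotes the lattice generated by $L$ and $x_1,\dots,x_k$. $(\bm{A}_1)^4=\langle \pm(\varepsilon_1\pm\varepsilon_2),\pm(\varepsilon_3\pm\varepsilon_4)\rangle$; $\bm{D}_4=\langle\pm\varepsilon_i\pm\varepsilon_j:1\le i<j\le4\rangle$. *)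

theory Defs
  imports "HOL-Analysis.Analysis"
begin

text \<open>A real vector space as a \<open>\<int>\<close>-module; the subgroup generated by a set is its
  span in this module.\<close>

abbreviation int_scale :: "int \<Rightarrow> 'a::real_vector \<Rightarrow> 'a" where
  "int_scale n x \<equiv> real_of_int n *\<^sub>R x"

lemma module_int_scale: "module (int_scale :: int \<Rightarrow> 'a::real_vector \<Rightarrow> 'a)"
  by unfold_locales (auto simp: algebra_simps)

definition int_span :: "'a::real_vector set \<Rightarrow> 'a set" where
  "int_span S = module.span int_scale S"

definition is_lattice :: "'a::euclidean_space set \<Rightarrow> bool" where
  "is_lattice L \<longleftrightarrow> (\<exists>B. finite B \<and> independent B \<and> L = int_span B)"

definition integral_lattice :: "'a::euclidean_space set \<Rightarrow> bool" where
  "integral_lattice L \<longleftrightarrow> is_lattice L \<and> (\<forall>x\<in>L. \<forall>y\<in>L. x \<bullet> y \<in> \<int>)"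

definition adjoin :: "'a::euclidean_space set \<Rightarrow> 'a set \<Rightarrow> 'a set" where
  "adjoin L X = int_span (L \<union> X)"

text \<open>Isometries act on the whole ambient space. For full-rank lattices this is the same as a
  group isomorphism preserving inner products, which extends uniquely to the ambient space.\<close>

definition isometric_lattices :: "'a::euclidean_space set \<Rightarrow> 'a set \<Rightarrow> bool" where
  "isometric_lattices L L' \<longleftrightarrow> (\<exists>f. orthogonal_transformation f \<and> f ` L = L')"

text \<open>In the index type \<open>4\<close> the numerals \<open>1\<close>, \<open>2\<close>, \<open>3\<close>, \<open>4\<close> denote the four distinct
  elements, with \<open>4 = 0\<close>.\<close>

definition \<epsilon> :: "4 \<Rightarrow> real^4" where
  "\<epsilon> i = axis i 1"

definition Lambda4 :: "(real^4) set" where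
  "Lambda4 = int_span {2 *\<^sub>R \<epsilon> 1, 2 *\<^sub>R \<epsilon> 2, 2 *\<^sub>R \<epsilon> 3, \<epsilon> 1 + \<epsilon> 2 + \<epsilon> 3 + \<epsilon> 4}"

definition A1_pow4 :: "(real^4) set" where
  "A1_pow4 = int_span
     ({s *\<^sub>R (\<epsilon> 1 + t *\<^sub>R \<epsilon> 2) | s t. s \<in> {1, -1} \<and> t \<in> {1, -1}} \<union>
      {s *\<^sub>R (\<epsilon> 3 + t *\<^sub>R \<epsilon> 4) | s t. s \<in> {1, -1} \<and> t \<in> {1, -1}})"

text \<open>The generators are symmetric in \<open>i\<close> and \<open>j\<close>, so \<open>i \<noteq> j\<close> gives the same set as
  \<open>1 \<le> i < j \<le> 4\<close>.\<close>

definition D4 :: "(real^4) set" where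
  "D4 = int_span {s *\<^sub>R \<epsilon> i + t *\<^sub>R \<epsilon> j | s t i j. s \<in> {1, -1} \<and> t \<in> {1, -1} \<and> i \<noteq> j}"

definition Z4 :: "(real^4) set" where
  "Z4 = {x. \<forall>i. x $ i \<in> \<int>}"

end

theory Submission
  imports Defs
begin

text \<open>Integrality of \<open>x \<bullet> (2 *\<^sub>R \<epsilon> i)\<close> and of \<open>x \<bullet> x\<close> forces every \<open>x \<in> M\<close> to lie in \<open>\<int>\<^sup>4\<close> or to have
  all four coordinates in \<open>\<int> + 1/2\<close>. In the second case \<open>M\<close> contains a unit vector \<open>h\<close> with
  coordinates \<open>\<plusminus>1/2\<close> and \<open>h $ 1 = 1/2\<close>; the reflection exchanging \<open>h\<close> and \<open>\<epsilon> 1\<close> maps \<open>M\<close> to an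
  integral lattice that again contains \<open>\<Lambda>\<^sub>4\<close>, and also \<open>\<epsilon> 1\<close>, so it contains no half-integral
  vector. Hence \<open>M\<close> may be taken between \<open>\<Lambda>\<^sub>4\<close> and \<open>\<int>\<^sup>4\<close>. Such an \<open>M\<close> amounts to a binary code of
  length 4 containing the all-ones word, since \<open>2\<int>\<^sup>4 \<subseteq> \<Lambda>\<^sub>4\<close>; up to complement its words are
  \<open>0\<close>, \<open>\<epsilon> i\<close> and \<open>\<epsilon> 1 + \<epsilon> j\<close>, and up to permutation of coordinates, realised by the reflections
  in \<open>\<epsilon> i - \<epsilon> j\<close>, there are six such codes.\<close>

section \<open>Integer submodules and integer spans\<close>

interpretation int_module: module "int_scale :: int \<Rightarrow> 'a::real_vector \<Rightarrow> 'a"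
  by (rule module_int_scale)

abbreviation "int_submodule \<equiv> module.subspace (int_scale :: int \<Rightarrow> real^4 \<Rightarrow> real^4)"

lemma int_submodule_linear_image:
  assumes "linear f" "int_submodule M"
  shows "int_submodule (f ` M)"
  unfolding int_module.subspace_def
proof (intro conjI ballI allI)
  show "0 \<in> f ` M"
    using assms linear_0[of f] int_module.subspace_0 by (metis image_eqI)
next
  fix x y assume "x \<in> f ` M" "y \<in> f ` M"
  then show "x + y \<in> f ` M"
    using assms int_module.subspace_add by (smt (verit) imageE image_eqI linear_add)
next
  fix c :: int and x assume "x \<in> f ` M"
  then show "int_scale c x \<in> f ` M"
    using assms int_module.subspace_scale by (smt (verit) imageE image_eqI linear_scale)
qed

lemma int_span_subset_iff:
  assumes "int_submodule M"
  shows "int_span S \<subseteq> M \<longleftrightarrow> S \<subseteq> M"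
  unfolding int_span_def
  using assms int_module.span_minimal int_module.span_superset by blast

lemma int_submodule_int_span: "int_submodule (int_span S)"
  unfolding int_span_def by (rule int_module.subspace_span)

lemma subset_int_span: "S \<subseteq> int_span S"
  unfolding int_span_def by (rule int_module.span_superset)

section \<open>Coordinates and membership modulo \<open>Lambda4\<close>\<close>

lemma \<epsilon>_nth [simp]: "\<epsilon> i $ j = (if j = i then 1 else 0)"
  by (simp add: \<epsilon>_def axis_def)

lemma inner_\<epsilon> [simp]: "x \<bullet> \<epsilon> i = x $ i" "\<epsilon> i \<bullet> x = x $ i"
  by (simp_all add: \<epsilon>_def inner_axis inner_axis')

text \<open>Only 2\<epsilon> 4 is missing from the generators: it is twice the all-ones vector minus
  the other three doubled basis vectors.\<close>

lemma double_\<epsilon>_mem: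
  assumes "int_submodule M" "Lambda4 \<subseteq> M"
  shows "2 *\<^sub>R \<epsilon> i \<in> M"
proof -
  have gens: "2 *\<^sub>R \<epsilon> 1 \<in> M" "2 *\<^sub>R \<epsilon> 2 \<in> M" "2 *\<^sub>R \<epsilon> 3 \<in> M" "\<epsilon> 1 + \<epsilon> 2 + \<epsilon> 3 + \<epsilon> 4 \<in> M"
    using assms unfolding Lambda4_def int_span_subset_iff[OF assms(1)] by auto
  have "int_scale 2 (\<epsilon> 1 + \<epsilon> 2 + \<epsilon> 3 + \<epsilon> 4) - 2 *\<^sub>R \<epsilon> 1 - 2 *\<^sub>R \<epsilon> 2 - 2 *\<^sub>R \<epsilon> 3 \<in> M"
    using gens by (intro int_module.subspace_diff int_module.subspace_scale assms)
  also have "int_scale 2 (\<epsilon> 1 + \<epsilon> 2 + \<epsilon> 3 + \<epsilon> 4) - 2 *\<^sub>R \<epsilon> 1 - 2 *\<^sub>R \<epsilon> 2 - 2 *\<^sub>R \<epsilon> 3 = 2 *\<^sub>R \<epsilon> 4"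
    by (simp add: algebra_simps)
  finally show ?thesis
    using gens exhaust_4[of i] by auto
qed

text \<open>A criterion symmetric in the four coordinates, convenient for checking images under
  reflections.\<close>

lemma Lambda4_subset_iff:
  assumes "int_submodule M"
  shows "Lambda4 \<subseteq> M \<longleftrightarrow> (\<forall>i. 2 *\<^sub>R \<epsilon> i \<in> M) \<and> \<epsilon> 1 + \<epsilon> 2 + \<epsilon> 3 + \<epsilon> 4 \<in> M"
proof
  assume L: "Lambda4 \<subseteq> M"
  have "\<epsilon> 1 + \<epsilon> 2 + \<epsilon> 3 + \<epsilon> 4 \<in> Lambda4"
    unfolding Lambda4_def by (rule subsetD[OF subset_int_span]) simp
  with L show "(\<forall>i. 2 *\<^sub>R \<epsilon> i \<in> M) \<and> \<epsilon> 1 + \<epsilon> 2 + \<epsilon> 3 + \<epsilon> 4 \<in> M"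
    using double_\<epsilon>_mem[OF assms L] by blast
next
  assume R: "(\<forall>i. 2 *\<^sub>R \<epsilon> i \<in> M) \<and> \<epsilon> 1 + \<epsilon> 2 + \<epsilon> 3 + \<epsilon> 4 \<in> M"
  then have "2 *\<^sub>R \<epsilon> 1 \<in> M" "2 *\<^sub>R \<epsilon> 2 \<in> M" "2 *\<^sub>R \<epsilon> 3 \<in> M"
    by blast+
  with R show "Lambda4 \<subseteq> M"
    unfolding Lambda4_def int_span_subset_iff[OF assms] by blast
qed

lemma even_vector_mem:
  assumes "int_submodule M" "Lambda4 \<subseteq> M" and even: "\<And>i. \<exists>k::int. x $ i = 2 * of_int k"
  shows "x \<in> M"
proof -
  obtain k :: "4 \<Rightarrow> int" where k: "\<And>i. x $ i = 2 * of_int (k i)"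
    using even by metis
  have "(\<Sum>i\<in>UNIV. int_scale (k i) (2 *\<^sub>R \<epsilon> i)) \<in> M"
    using double_\<epsilon>_mem[OF assms(1,2)]
    by (intro int_module.subspace_sum int_module.subspace_scale assms(1))
  also have "(\<Sum>i\<in>UNIV. int_scale (k i) (2 *\<^sub>R \<epsilon> i)) = x"
    by (simp add: vec_eq_iff k sum_4 forall_4)
  finally show ?thesis .
qed

text \<open>Membership is invariant under complementing a code word.\<close>

lemma all_ones_diff_mem:
  assumes "int_submodule M" "Lambda4 \<subseteq> M"
  shows "\<epsilon> 1 + \<epsilon> 2 + \<epsilon> 3 + \<epsilon> 4 - x \<in> M \<longleftrightarrow> x \<in> M"
proof -
  have "\<epsilon> 1 + \<epsilon> 2 + \<epsilon> 3 + \<epsilon> 4 \<in> M"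
    using assms Lambda4_subset_iff by blast
  from int_module.subspace_diff[OF assms(1) this, of x]
    int_module.subspace_diff[OF assms(1) this, of "\<epsilon> 1 + \<epsilon> 2 + \<epsilon> 3 + \<epsilon> 4 - x"] show ?thesis
    by auto
qed

lemma \<epsilon>_add_mem_compl:
  assumes M: "int_submodule M" "Lambda4 \<subseteq> M"
  shows "\<epsilon> 2 + \<epsilon> 3 \<in> M \<longleftrightarrow> \<epsilon> 1 + \<epsilon> 4 \<in> M"
    and "\<epsilon> 2 + \<epsilon> 4 \<in> M \<longleftrightarrow> \<epsilon> 1 + \<epsilon> 3 \<in> M"
    and "\<epsilon> 3 + \<epsilon> 4 \<in> M \<longleftrightarrow> \<epsilon> 1 + \<epsilon> 2 \<in> M"
proof -
  have "\<epsilon> 1 + \<epsilon> 2 + \<epsilon> 3 + \<epsilon> 4 - (\<epsilon> 1 + \<epsilon> 4) = \<epsilon> 2 + \<epsilon> 3"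
    "\<epsilon> 1 + \<epsilon> 2 + \<epsilon> 3 + \<epsilon> 4 - (\<epsilon> 1 + \<epsilon> 3) = \<epsilon> 2 + \<epsilon> 4"
    "\<epsilon> 1 + \<epsilon> 2 + \<epsilon> 3 + \<epsilon> 4 - (\<epsilon> 1 + \<epsilon> 2) = \<epsilon> 3 + \<epsilon> 4"
    by (simp_all add: vec_eq_iff)
  then show "\<epsilon> 2 + \<epsilon> 3 \<in> M \<longleftrightarrow> \<epsilon> 1 + \<epsilon> 4 \<in> M"
    "\<epsilon> 2 + \<epsilon> 4 \<in> M \<longleftrightarrow> \<epsilon> 1 + \<epsilon> 3 \<in> M"
    "\<epsilon> 3 + \<epsilon> 4 \<in> M \<longleftrightarrow> \<epsilon> 1 + \<epsilon> 2 \<in> M"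
    using all_ones_diff_mem[OF M] by metis+
qed

text \<open>The representative is chosen from \<open>x\<close> alone, before any \<open>M\<close>;
  this lets it serve two lattices at once. It arises by reducing coordinates mod 2 and complementing
  if necessary.\<close>

lemma integer_vector_representative:
  assumes "x \<in> Z4"
  obtains r where "r = 0 \<or> (\<exists>i. r = \<epsilon> i) \<or> (\<exists>j. j \<noteq> 1 \<and> r = \<epsilon> 1 + \<epsilon> j)"
    "\<And>M. int_submodule M \<Longrightarrow> Lambda4 \<subseteq> M \<Longrightarrow> x \<in> M \<longleftrightarrow> r \<in> M"
proof -
  obtain n :: "4 \<Rightarrow> int" where n: "\<And>i. x $ i = of_int (n i)"
  proof -
    have "\<forall>i. \<exists>n::int. x $ i = of_int n"
      using assms by (auto simp: Z4_def elim: Ints_cases)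
    then show ?thesis using that by metis
  qed
  define v :: "real^4" where "v = (\<chi> i. of_int (n i mod 2))"
  have "\<exists>k::int. (x - v) $ i = 2 * of_int k" for i
  proof -
    have "n i - n i mod 2 = 2 * (n i div 2)"
      by presburger
    then have "real_of_int (n i) - of_int (n i mod 2) = 2 * of_int (n i div 2)"
      by (metis of_int_diff of_int_mult of_int_numeral)
    then show ?thesis
      using n by (auto simp: v_def)
  qed
  then have diff: "x - v \<in> M" if "int_submodule M" "Lambda4 \<subseteq> M" for M
    using even_vector_mem that by blast
  have mem: "x \<in> M \<longleftrightarrow> v \<in> M" if M: "int_submodule M" "Lambda4 \<subseteq> M" for M
    using int_module.subspace_add[OF M(1), of "x - v" v]
      int_module.subspace_diff[OF M(1), of x "x - v"] diff[OF M] by auto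
  \<comment> \<open>One word from each of the eight complementary pairs among the 16 binary words:
    weight at most one, or weight two with first coordinate 1.\<close>
  let ?R = "{0, \<epsilon> 1, \<epsilon> 2, \<epsilon> 3, \<epsilon> 4, \<epsilon> 1 + \<epsilon> 2, \<epsilon> 1 + \<epsilon> 3, \<epsilon> 1 + \<epsilon> 4}"
  have "v $ i = 0 \<or> v $ i = 1" for i
    by (auto simp: v_def)
  from this[of 1] this[of 2] this[of 3] this[of 4]
  have "v \<in> ?R \<or> \<epsilon> 1 + \<epsilon> 2 + \<epsilon> 3 + \<epsilon> 4 - v \<in> ?R"
    unfolding insert_iff empty_iff vec_eq_iff forall_4
    by (elim disjE; simp)
  then obtain r where r: "r \<in> ?R" "r = v \<or> r = \<epsilon> 1 + \<epsilon> 2 + \<epsilon> 3 + \<epsilon> 4 - v"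
    by blast
  show thesis
  proof
    have "(2::4) \<noteq> 1 \<and> (3::4) \<noteq> 1 \<and> (4::4) \<noteq> 1"
      by simp
    with r(1) show "r = 0 \<or> (\<exists>i. r = \<epsilon> i) \<or> (\<exists>j. j \<noteq> 1 \<and> r = \<epsilon> 1 + \<epsilon> j)"
      by blast
    show "x \<in> M \<longleftrightarrow> r \<in> M" if "int_submodule M" "Lambda4 \<subseteq> M" for M
      using mem[OF that] r(2) all_ones_diff_mem[OF that, of v] by auto
  qed
qed

text \<open>Any \<open>x\<close> in \<open>M\<close> may be replaced by its representative in both
  lattices, so equality is tested on seven nonzero vectors.\<close>

lemma eq_if_agree_on_\<epsilon>:
  assumes M: "int_submodule M" "M \<subseteq> Z4" and N: "int_submodule N" "Lambda4 \<subseteq> N" "N \<subseteq> M"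
    and "\<And>i. \<epsilon> i \<in> M \<Longrightarrow> \<epsilon> i \<in> N"
    and "\<And>j. j \<noteq> 1 \<Longrightarrow> \<epsilon> 1 + \<epsilon> j \<in> M \<Longrightarrow> \<epsilon> 1 + \<epsilon> j \<in> N"
  shows "M = N"
proof
  show "M \<subseteq> N"
  proof
    fix x assume x: "x \<in> M"
    with M have "x \<in> Z4" by blast
    then obtain r where r: "r = 0 \<or> (\<exists>i. r = \<epsilon> i) \<or> (\<exists>j. j \<noteq> 1 \<and> r = \<epsilon> 1 + \<epsilon> j)"
      "\<And>M. int_submodule M \<Longrightarrow> Lambda4 \<subseteq> M \<Longrightarrow> x \<in> M \<longleftrightarrow> r \<in> M"
      by (rule integer_vector_representative) blast
    have "r \<in> M"
      using r(2)[of M] x M N by blast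
    then have "r \<in> N"
      using r(1) assms int_module.subspace_0[OF N(1)] by blast
    then show "x \<in> N"
      using r(2)[of N] N by blast
  qed
qed (fact N)

section \<open>Reflections and transport of the classification\<close>

definition reflection :: "'a::euclidean_space \<Rightarrow> 'a \<Rightarrow> 'a" where
  "reflection w x = x - (2 * (x \<bullet> w) / (w \<bullet> w)) *\<^sub>R w"

lemma orthogonal_transformation_reflection: "orthogonal_transformation (reflection w)"
  unfolding orthogonal_transformation_def
proof (intro conjI allI)
  show "linear (reflection w)"
    by (rule linearI)
      (simp_all add: reflection_def algebra_simps add_divide_distrib)
  \<comment> \<open>For \<open>w = 0\<close> the map is the identity.\<close>
  show "reflection w x \<bullet> reflection w y = x \<bullet> y" for x y
    by (cases "w = 0") (simp_all add: reflection_def algebra_simps inner_commute)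
qed

lemma linear_reflection: "linear (reflection w)"
  using orthogonal_transformation_reflection orthogonal_transformation_linear by blast

lemma reflection_involution [simp]: "reflection w (reflection w x) = x"
  by (cases "w = 0") (simp_all add: reflection_def algebra_simps)

lemma mem_reflection_image_iff: "x \<in> reflection w ` M \<longleftrightarrow> reflection w x \<in> M"
  by (metis image_iff reflection_involution)

text \<open>The root has squared norm 2, so the coefficient subtracted is
  \<open>x $ i - x $ j\<close>, which exchanges the two coordinates.\<close>

lemma reflection_\<epsilon>_diff:
  assumes "i \<noteq> j"
  shows "reflection (\<epsilon> i - \<epsilon> j) x = (\<chi> k. x $ Transposition.transpose i j k)"
proof -
  have "(\<epsilon> i - \<epsilon> j) \<bullet> (\<epsilon> i - \<epsilon> j) = 2"
    using assms by (simp add: inner_diff_right)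
  then show ?thesis
    using assms by (auto simp: reflection_def vec_eq_iff inner_diff_right Transposition.transpose_def field_simps)
qed

lemma reflection_\<epsilon>_diff_\<epsilon>:
  assumes "i \<noteq> j"
  shows "reflection (\<epsilon> i - \<epsilon> j) (\<epsilon> k) = \<epsilon> (Transposition.transpose i j k)"
  unfolding reflection_\<epsilon>_diff[OF assms]
  by (auto simp: vec_eq_iff Transposition.transpose_def)

text \<open>Names the conclusion of the classification so that it can be pulled back along
  isometries.\<close>

definition classified :: "(real^4) set \<Rightarrow> bool" where
  "classified M \<longleftrightarrow>
     (\<exists>N \<in> {Lambda4, adjoin Lambda4 {\<epsilon> 1}, adjoin Lambda4 {\<epsilon> 1, \<epsilon> 2}, A1_pow4, D4, Z4}.
        isometric_lattices M N)"

lemma classified_image: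
  assumes "orthogonal_transformation f" "classified (f ` M)"
  shows "classified M"
proof -
  have "isometric_lattices M N" if "isometric_lattices (f ` M) N" for N
    using that orthogonal_transformation_compose[OF _ assms(1)]
    unfolding isometric_lattices_def by (metis image_comp)
  then show ?thesis
    using assms(2) unfolding classified_def by blast
qed

lemma isometric_lattices_refl: "isometric_lattices M M"
  unfolding isometric_lattices_def
  by (rule exI[of _ "\<lambda>x. x"]) simp

section \<open>Lattices between \<open>Lambda4\<close> and \<open>Z4\<close>\<close>

locale intermediate_lattice =
  fixes M :: "(real^4) set"
  assumes submodule: "int_submodule M"
    and Lambda4_subset: "Lambda4 \<subseteq> M"
    and subset_Z4: "M \<subseteq> Z4"
begin

lemmas add_mem = int_module.subspace_add[OF submodule]
lemmas diff_mem = int_module.subspace_diff[OF submodule]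
lemmas zero_mem = int_module.subspace_0[OF submodule]

lemma uminus_mem: "x \<in> M \<Longrightarrow> - x \<in> M"
  using diff_mem[OF zero_mem] by simp

lemma add_mem_iff: "x \<in> M \<Longrightarrow> x + y \<in> M \<longleftrightarrow> y \<in> M"
  using add_mem[of x y] diff_mem[of "x + y" x] by auto

text \<open>Signs are invisible modulo 2\<epsilon> j.\<close>

lemma \<epsilon>_diff_mem_iff: "x - \<epsilon> j \<in> M \<longleftrightarrow> x + \<epsilon> j \<in> M"
proof -
  have "x + \<epsilon> j = 2 *\<^sub>R \<epsilon> j + (x - \<epsilon> j)"
    by (simp add: scaleR_2)
  then show ?thesis
    using add_mem_iff[OF double_\<epsilon>_mem[OF submodule Lambda4_subset]] by metis
qed

lemma signed_\<epsilon>_add_mem: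
  assumes "\<epsilon> i + \<epsilon> j \<in> M" "s \<in> {1, -1}" "t \<in> {1, -1}"
  shows "s *\<^sub>R \<epsilon> i + t *\<^sub>R \<epsilon> j \<in> M"
proof -
  have "\<epsilon> i + \<epsilon> j \<in> M" "\<epsilon> i - \<epsilon> j \<in> M" "- (\<epsilon> i + \<epsilon> j) \<in> M" "- (\<epsilon> i - \<epsilon> j) \<in> M"
    using assms(1) \<epsilon>_diff_mem_iff uminus_mem by blast+
  then show ?thesis
    using assms(2,3) by auto
qed

text \<open>A coordinate swap permutes the vectors 2\<epsilon> k, fixes the all-ones vector and
  preserves integrality of coordinates. This justifies relabelling coordinates in the case
  analysis.\<close>

lemma intermediate_lattice_swap:
  assumes "i \<noteq> j"
  shows "intermediate_lattice (reflection (\<epsilon> i - \<epsilon> j) ` M)"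
proof
  let ?r = "reflection (\<epsilon> i - \<epsilon> j)"
  show sub: "int_submodule (?r ` M)"
    using submodule linear_reflection int_submodule_linear_image by blast
  have "?r (2 *\<^sub>R \<epsilon> k) \<in> M" for k
    unfolding linear_scale[OF linear_reflection] reflection_\<epsilon>_diff_\<epsilon>[OF assms]
    using double_\<epsilon>_mem[OF submodule Lambda4_subset] .
  moreover have "\<epsilon> 1 + \<epsilon> 2 + \<epsilon> 3 + \<epsilon> 4 = (\<chi> k. 1)"
    by (simp add: vec_eq_iff forall_4)
  then have "?r (\<epsilon> 1 + \<epsilon> 2 + \<epsilon> 3 + \<epsilon> 4) = \<epsilon> 1 + \<epsilon> 2 + \<epsilon> 3 + \<epsilon> 4"
    using assms by (simp add: reflection_\<epsilon>_diff)
  then have "?r (\<epsilon> 1 + \<epsilon> 2 + \<epsilon> 3 + \<epsilon> 4) \<in> M"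
    using Lambda4_subset Lambda4_subset_iff[OF submodule] by simp
  ultimately show "Lambda4 \<subseteq> ?r ` M"
    unfolding Lambda4_subset_iff[OF sub] mem_reflection_image_iff by blast
  show "?r ` M \<subseteq> Z4"
    using subset_Z4 assms by (auto simp: reflection_\<epsilon>_diff Z4_def)
qed

lemma \<epsilon>_mem_swap_iff:
  assumes "i \<noteq> j"
  shows "\<epsilon> k \<in> reflection (\<epsilon> i - \<epsilon> j) ` M \<longleftrightarrow> \<epsilon> (Transposition.transpose i j k) \<in> M"
    and "\<epsilon> k + \<epsilon> l \<in> reflection (\<epsilon> i - \<epsilon> j) ` M \<longleftrightarrow>
      \<epsilon> (Transposition.transpose i j k) + \<epsilon> (Transposition.transpose i j l) \<in> M"
  unfolding mem_reflection_image_iff linear_add[OF linear_reflection]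
    reflection_\<epsilon>_diff_\<epsilon>[OF assms] by simp_all

text \<open>The five candidates here are integer spans by definition, hence submodules;
  \<open>Z4\<close> is defined by coordinates and is treated directly.\<close>

lemma classified_if_subset:
  assumes N: "N \<in> {Lambda4, adjoin Lambda4 {\<epsilon> 1}, adjoin Lambda4 {\<epsilon> 1, \<epsilon> 2}, A1_pow4, D4}"
    and "Lambda4 \<subseteq> N" "N \<subseteq> M"
    and "\<And>i. \<epsilon> i \<in> M \<Longrightarrow> \<epsilon> i \<in> N"
    and "\<And>j. j \<noteq> 1 \<Longrightarrow> \<epsilon> 1 + \<epsilon> j \<in> M \<Longrightarrow> \<epsilon> 1 + \<epsilon> j \<in> N"
  shows "classified M"
proof -
  have "int_submodule N"
    using N int_submodule_int_span unfolding Lambda4_def A1_pow4_def D4_def adjoin_def by blast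
  then have "M = N"
    using assms submodule subset_Z4 by (intro eq_if_agree_on_\<epsilon>) auto
  then show ?thesis
    using N isometric_lattices_refl unfolding classified_def by blast
qed

lemma adjoin_subset: "X \<subseteq> M \<Longrightarrow> adjoin Lambda4 X \<subseteq> M"
  unfolding adjoin_def int_span_subset_iff[OF submodule] using Lambda4_subset by blast

lemma classified_if_\<epsilon>_12:
  assumes "\<epsilon> 1 \<in> M" "\<epsilon> 2 \<in> M"
  shows "classified M"
proof (cases "\<epsilon> 3 \<in> M \<or> \<epsilon> 4 \<in> M")
  case True
  \<comment> \<open>The complement of \<epsilon> 1 + \<epsilon> 2; it makes \<epsilon> 3 and
    \<epsilon> 4 occur together or not at all.\<close>
  have "\<epsilon> 3 + \<epsilon> 4 \<in> M"
    using \<epsilon>_add_mem_compl(3)[OF submodule Lambda4_subset] add_mem assms by blast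
  with True have "\<epsilon> 3 \<in> M" "\<epsilon> 4 \<in> M"
    using add_mem_iff[of "\<epsilon> 3" "\<epsilon> 4"] add_mem_iff[of "\<epsilon> 4" "\<epsilon> 3"] by (auto simp: add.commute)
  with assms have \<epsilon>: "\<epsilon> i \<in> M" for i
    using exhaust_4[of i] by auto
  have "Z4 \<subseteq> M"
  proof
    fix x assume "x \<in> Z4"
    then have "\<forall>i. \<exists>n::int. x $ i = of_int n"
      by (auto simp: Z4_def elim: Ints_cases)
    then obtain n :: "4 \<Rightarrow> int" where n: "\<And>i. x $ i = of_int (n i)"
      by metis
    have "(\<Sum>i\<in>UNIV. int_scale (n i) (\<epsilon> i)) \<in> M"
      using \<epsilon> by (intro int_module.subspace_sum int_module.subspace_scale submodule)
    also have "(\<Sum>i\<in>UNIV. int_scale (n i) (\<epsilon> i)) = x"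
      by (simp add: vec_eq_iff n sum_4 forall_4)
    finally show "x \<in> M" .
  qed
  with subset_Z4 have "M = Z4"
    by blast
  then show ?thesis
    using isometric_lattices_refl unfolding classified_def by blast
next
  case False
  let ?N = "adjoin Lambda4 {\<epsilon> 1, \<epsilon> 2}"
  have N: "int_submodule ?N" "Lambda4 \<subseteq> ?N" "\<epsilon> 1 \<in> ?N" "\<epsilon> 2 \<in> ?N"
    unfolding adjoin_def using int_submodule_int_span subset_int_span[of "Lambda4 \<union> {\<epsilon> 1, \<epsilon> 2}"]
    by auto
  show ?thesis
  proof (rule classified_if_subset)
    show "?N \<subseteq> M"
      using assms by (intro adjoin_subset) auto
    show \<epsilon>: "\<epsilon> i \<in> ?N" if "\<epsilon> i \<in> M" for i
      using that False N exhaust_4[of i] by auto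
    show "\<epsilon> 1 + \<epsilon> j \<in> ?N" if "\<epsilon> 1 + \<epsilon> j \<in> M" for j
      using that \<epsilon> N add_mem_iff[OF assms(1)] int_module.subspace_add by blast
  qed (use N in auto)
qed

lemma classified_if_\<epsilon>_1:
  assumes "\<epsilon> 1 \<in> M"
  shows "classified M"
proof (cases "\<exists>j. j \<noteq> 1 \<and> \<epsilon> j \<in> M")
  case True
  then obtain j where j: "j \<noteq> 1" "\<epsilon> j \<in> M"
    by blast
  show ?thesis
  proof (cases "j = 2")
    case True
    with assms j show ?thesis
      by (intro classified_if_\<epsilon>_12) auto
  next
    case False
    \<comment> \<open>As neither \<open>j\<close> nor 2 equals 1, the swap keeps \<epsilon> 1 and
      brings \<epsilon> j to \<epsilon> 2.\<close>
    interpret swap: intermediate_lattice "reflection (\<epsilon> j - \<epsilon> 2) ` M"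
      using False by (rule intermediate_lattice_swap)
    have "classified (reflection (\<epsilon> j - \<epsilon> 2) ` M)"
      using assms j False
      by (intro swap.classified_if_\<epsilon>_12)
        (auto simp: \<epsilon>_mem_swap_iff Transposition.transpose_def)
    then show ?thesis
      using classified_image orthogonal_transformation_reflection by blast
  qed
next
  case False
  let ?N = "adjoin Lambda4 {\<epsilon> 1}"
  have N: "Lambda4 \<subseteq> ?N" "\<epsilon> 1 \<in> ?N"
    unfolding adjoin_def using subset_int_span[of "Lambda4 \<union> {\<epsilon> 1}"] by auto
  show ?thesis
  proof (rule classified_if_subset)
    show "?N \<subseteq> M"
      using assms by (intro adjoin_subset) auto
    show "\<epsilon> i \<in> ?N" if "\<epsilon> i \<in> M" for i
      using that False N by metis
    \<comment> \<open>Vacuous: together with \<epsilon> 1 such a sum would put \<epsilon> j into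
      \<open>M\<close>.\<close>
    show "\<epsilon> 1 + \<epsilon> j \<in> ?N" if "j \<noteq> 1" "\<epsilon> 1 + \<epsilon> j \<in> M" for j
      using that False add_mem_iff[OF assms] by blast
  qed (use N in auto)
qed

lemma classified_if_\<epsilon>:
  assumes "\<epsilon> i \<in> M"
  shows "classified M"
proof (cases "i = 1")
  case False
  interpret swap: intermediate_lattice "reflection (\<epsilon> i - \<epsilon> 1) ` M"
    using False by (rule intermediate_lattice_swap)
  have "classified (reflection (\<epsilon> i - \<epsilon> 1) ` M)"
    using assms False by (intro swap.classified_if_\<epsilon>_1) (simp add: \<epsilon>_mem_swap_iff)
  then show ?thesis
    using classified_image orthogonal_transformation_reflection by blast
qed (use assms classified_if_\<epsilon>_1 in simp)

text \<open>Modulo 2, adding the word {1,2} to {1,3} gives {2,3}, whose complement is {1,4}.\<close>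

lemma \<epsilon>_1_add_mem_iff:
  assumes "\<epsilon> 1 + \<epsilon> 2 \<in> M"
  shows "\<epsilon> 1 + \<epsilon> 3 \<in> M \<longleftrightarrow> \<epsilon> 1 + \<epsilon> 4 \<in> M"
proof -
  \<comment> \<open>The right-hand vector is \<epsilon> 3 - \<epsilon> 1; adding \<epsilon> 1 +
    \<epsilon> 2 to it cancels \<epsilon> 1.\<close>
  have "\<epsilon> 1 + \<epsilon> 3 \<in> M \<longleftrightarrow> (\<epsilon> 1 + \<epsilon> 3) - \<epsilon> 1 - \<epsilon> 1 \<in> M"
    using double_\<epsilon>_mem[OF submodule Lambda4_subset, of 1]
      add_mem_iff[of "2 *\<^sub>R \<epsilon> 1" "(\<epsilon> 1 + \<epsilon> 3) - \<epsilon> 1 - \<epsilon> 1"]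
    by (simp add: scaleR_2)
  also have "\<dots> \<longleftrightarrow> \<epsilon> 2 + \<epsilon> 3 \<in> M"
    using add_mem_iff[OF assms, of "(\<epsilon> 1 + \<epsilon> 3) - \<epsilon> 1 - \<epsilon> 1"] by (simp add: add.commute)
  also have "\<dots> \<longleftrightarrow> \<epsilon> 1 + \<epsilon> 4 \<in> M"
    using \<epsilon>_add_mem_compl(1)[OF submodule Lambda4_subset] .
  finally show ?thesis .
qed

text \<open>Without words of weight one, only pairs matter. Either all six pairs occur, giving
  \<open>D4\<close>, or just {1,2} and its complement {3,4}, giving \<open>A1_pow4\<close>.\<close>

lemma classified_if_\<epsilon>_1_add_\<epsilon>_2:
  assumes no: "\<And>i. \<epsilon> i \<notin> M" and 12: "\<epsilon> 1 + \<epsilon> 2 \<in> M"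
  shows "classified M"
proof (cases "\<epsilon> 1 + \<epsilon> 3 \<in> M")
  case True
  have pair: "\<epsilon> i + \<epsilon> j \<in> M" if "i \<noteq> j" for i j
    using that 12 True \<epsilon>_1_add_mem_iff[OF 12] \<epsilon>_add_mem_compl[OF submodule Lambda4_subset]
      exhaust_4[of i] exhaust_4[of j] by (auto simp: add.commute)
  have gen: "s *\<^sub>R \<epsilon> i + t *\<^sub>R \<epsilon> j \<in> D4" if "i \<noteq> j" "s \<in> {1, -1}" "t \<in> {1, -1}" for s t i j
    unfolding D4_def using that by (intro subsetD[OF subset_int_span]) blast
  have plus: "\<epsilon> i + \<epsilon> j \<in> D4" if "i \<noteq> j" for i j
    using gen[OF that, of 1 1] by simp
  have sub: "int_submodule D4"
    unfolding D4_def by (rule int_submodule_int_span)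
  show ?thesis
  proof (rule classified_if_subset)
    have "2 *\<^sub>R \<epsilon> i \<in> D4" for i
    proof -
      obtain j :: 4 where j: "i \<noteq> j"
        using exhaust_4[of i] by (metis one_neq_zero)
      have "\<epsilon> i + \<epsilon> j \<in> D4" "\<epsilon> i - \<epsilon> j \<in> D4"
        using gen[OF j, of 1 1] gen[OF j, of 1 "-1"] by auto
      from int_module.subspace_add[OF sub this] show ?thesis
        by (simp add: scaleR_2)
    qed
    \<comment> \<open>The all-ones vector splits into two disjoint pairs.\<close>
    moreover have "\<epsilon> 1 + \<epsilon> 2 + (\<epsilon> 3 + \<epsilon> 4) \<in> D4"
      by (intro int_module.subspace_add[OF sub] plus) auto
    ultimately show "Lambda4 \<subseteq> D4"
      unfolding Lambda4_subset_iff[OF sub] by (simp add: add.assoc)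
    show "D4 \<subseteq> M"
      unfolding D4_def int_span_subset_iff[OF submodule]
      using pair signed_\<epsilon>_add_mem by blast
    show "\<epsilon> 1 + \<epsilon> j \<in> D4" if "j \<noteq> 1" for j
      using plus that by metis
  qed (use no in auto)
next
  case False
  have gen: "s *\<^sub>R (\<epsilon> 1 + t *\<^sub>R \<epsilon> 2) \<in> A1_pow4" "s *\<^sub>R (\<epsilon> 3 + t *\<^sub>R \<epsilon> 4) \<in> A1_pow4"
    if "s \<in> {1, -1}" "t \<in> {1, -1}" for s t
    unfolding A1_pow4_def using that by (intro subsetD[OF subset_int_span]; blast)+
  have mem: "\<epsilon> 1 + \<epsilon> 2 \<in> A1_pow4" "\<epsilon> 1 - \<epsilon> 2 \<in> A1_pow4" "\<epsilon> 3 + \<epsilon> 4 \<in> A1_pow4" "\<epsilon> 3 - \<epsilon> 4 \<in> A1_pow4"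
    using gen[of 1 1] gen[of 1 "-1"] by simp_all
  have sub: "int_submodule A1_pow4"
    unfolding A1_pow4_def by (rule int_submodule_int_span)
  note add = int_module.subspace_add[OF sub] and diff = int_module.subspace_diff[OF sub]
  show ?thesis
  proof (rule classified_if_subset)
    \<comment> \<open>Sums and differences of the two generators supported on the same pair.\<close>
    have "2 *\<^sub>R \<epsilon> i \<in> A1_pow4" for i
      using exhaust_4[of i] add[OF mem(1,2)] diff[OF mem(1,2)] add[OF mem(3,4)] diff[OF mem(3,4)]
      by (auto simp: scaleR_2)
    then show "Lambda4 \<subseteq> A1_pow4"
      unfolding Lambda4_subset_iff[OF sub] using add[OF mem(1,3)] by (simp add: add.assoc)
    have "\<epsilon> 3 + \<epsilon> 4 \<in> M"
      using \<epsilon>_add_mem_compl(3)[OF submodule Lambda4_subset] 12 by blast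
    \<comment> \<open>Distributing \<open>s\<close> leaves the signs \<open>s\<close> and
      \<open>s * t\<close>.\<close>
    then have "s *\<^sub>R (\<epsilon> 1 + t *\<^sub>R \<epsilon> 2) \<in> M \<and> s *\<^sub>R (\<epsilon> 3 + t *\<^sub>R \<epsilon> 4) \<in> M"
      if "s \<in> {1, -1}" "t \<in> {1, -1}" for s t
      using signed_\<epsilon>_add_mem[OF 12, of s "s * t"] signed_\<epsilon>_add_mem[of 3 4 s "s * t"] that
      by (auto simp: scaleR_add_right)
    then show "A1_pow4 \<subseteq> M"
      unfolding A1_pow4_def int_span_subset_iff[OF submodule] by blast
    \<comment> \<open>The indices 3 and 4 are excluded together, so \<open>j\<close> is 2.\<close>
    show "\<epsilon> 1 + \<epsilon> j \<in> A1_pow4" if "j \<noteq> 1" "\<epsilon> 1 + \<epsilon> j \<in> M" for j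
      using that False \<epsilon>_1_add_mem_iff[OF 12] mem exhaust_4[of j] by auto
  qed (use no in auto)
qed

lemma is_classified: "classified M"
proof (cases "\<exists>i. \<epsilon> i \<in> M")
  case True
  then show ?thesis
    using classified_if_\<epsilon> by blast
next
  case False
  then have no: "\<And>i. \<epsilon> i \<notin> M"
    by blast
  show ?thesis
  proof (cases "\<exists>j. j \<noteq> 1 \<and> \<epsilon> 1 + \<epsilon> j \<in> M")
    case True
    then obtain j where j: "j \<noteq> 1" "\<epsilon> 1 + \<epsilon> j \<in> M"
      by blast
    show ?thesis
    proof (cases "j = 2")
      case True
      with no j show ?thesis
        by (intro classified_if_\<epsilon>_1_add_\<epsilon>_2) auto
    next
      case False
      \<comment> \<open>The swap carries {1,j} to {1,2} and creates no word of weight one.\<close>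
      interpret swap: intermediate_lattice "reflection (\<epsilon> j - \<epsilon> 2) ` M"
        using False by (rule intermediate_lattice_swap)
      have "classified (reflection (\<epsilon> j - \<epsilon> 2) ` M)"
        using no j False
        by (intro swap.classified_if_\<epsilon>_1_add_\<epsilon>_2)
          (auto simp: \<epsilon>_mem_swap_iff Transposition.transpose_def)
      then show ?thesis
        using classified_image orthogonal_transformation_reflection by blast
    qed
  next
    case False
    \<comment> \<open>Up to complement only the zero word is left, so \<open>M\<close> is
      \<open>Lambda4\<close>.\<close>
    with no Lambda4_subset show ?thesis
      by (intro classified_if_subset[of Lambda4]) auto
  qed
qed

end

section \<open>Half-integral vectors and their removal by a reflection\<close>

lemma same_parity_if_4_dvd_sum_squares:
  fixes a b c d :: int
  assumes "4 dvd a\<^sup>2 + b\<^sup>2 + c\<^sup>2 + d\<^sup>2"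
  shows "(even a \<longleftrightarrow> even b) \<and> (even b \<longleftrightarrow> even c) \<and> (even c \<longleftrightarrow> even d)"
proof -
  have sq: "n\<^sup>2 mod 4 = n mod 2" for n :: int
  proof (cases "even n")
    case True
    then show ?thesis
      by (auto simp: power2_eq_square elim!: evenE)
  next
    case False
    then obtain k where "n = 2 * k + 1"
      by (rule oddE)
    then have "n\<^sup>2 = 1 + 4 * (k\<^sup>2 + k)"
      by (simp add: power2_eq_square algebra_simps)
    then have "n\<^sup>2 mod 4 = 1"
      by (simp only: mod_mult_self2) simp
    then show ?thesis
      using False by (simp add: odd_iff_mod_2_eq_one)
  qed
  have "(a mod 2 + b mod 2 + c mod 2 + d mod 2) mod 4 = (a\<^sup>2 + b\<^sup>2 + c\<^sup>2 + d\<^sup>2) mod 4"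
    unfolding sq[symmetric] by (intro mod_add_cong mod_mod_trivial)
  \<comment> \<open>The number of odd entries lies between 0 and 4 and is divisible by 4, so it is 0
    or 4.\<close>
  then have count: "(a mod 2 + b mod 2 + c mod 2 + d mod 2) mod 4 = 0"
    using assms by simp
  have range: "n mod 2 = 0 \<or> n mod 2 = 1" for n :: int
    by auto
  show ?thesis
    unfolding even_iff_mod_2_eq_zero using range[of a] range[of b] range[of c] range[of d] count
    by (elim disjE) simp_all
qed

text \<open>With \<open>n i\<close> the doubled coordinates, integrality of the norm says that 4
  divides the sum of their squares, so all \<open>n i\<close> have the same parity.\<close>

lemma integer_or_half_integer:
  assumes sub: "int_submodule M"
    and int: "\<And>u v. u \<in> M \<Longrightarrow> v \<in> M \<Longrightarrow> u \<bullet> v \<in> \<int>"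
    and L: "Lambda4 \<subseteq> M" and M: "x \<in> M"
  shows "x \<in> Z4 \<or> (\<exists>n :: 4 \<Rightarrow> int. \<forall>i. odd (n i) \<and> x $ i = of_int (n i) / 2)"
proof -
  note gens = L[unfolded Lambda4_subset_iff[OF sub]]
  have "\<forall>i. \<exists>n::int. 2 * x $ i = of_int n"
  proof
    fix i
    have "x \<bullet> (2 *\<^sub>R \<epsilon> i) \<in> \<int>"
      using gens M int by blast
    then show "\<exists>n::int. 2 * x $ i = of_int n"
      by (auto elim: Ints_cases)
  qed
  then obtain n :: "4 \<Rightarrow> int" where n: "\<And>i. 2 * x $ i = of_int (n i)"
    by metis
  then have x: "x $ i = of_int (n i) / 2" for i
    by (metis nonzero_mult_div_cancel_left zero_neq_numeral)
  have "x \<bullet> x \<in> \<int>"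
    using M int by blast
  then obtain t :: int where "x \<bullet> x = of_int t"
    by (auto elim: Ints_cases)
  then have "real_of_int ((n 1)\<^sup>2 + (n 2)\<^sup>2 + (n 3)\<^sup>2 + (n 4)\<^sup>2) = of_int (4 * t)"
    by (simp add: inner_vec_def sum_4 x power2_eq_square field_simps)
  then have t: "(n 1)\<^sup>2 + (n 2)\<^sup>2 + (n 3)\<^sup>2 + (n 4)\<^sup>2 = 4 * t"
    by (simp only: of_int_eq_iff)
  have "(\<forall>i. even (n i)) \<or> (\<forall>i. odd (n i))"
    using same_parity_if_4_dvd_sum_squares[of "n 1" "n 2" "n 3" "n 4"] t
    unfolding forall_4 by auto
  then show ?thesis
  proof
    assume "\<forall>i. even (n i)"
    then have "x $ i \<in> \<int>" for i
      unfolding x by (metis dvdE Ints_of_int nonzero_mult_div_cancel_left of_int_mult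
        of_int_numeral zero_neq_numeral)
    then show ?thesis
      by (simp add: Z4_def)
  next
    assume "\<forall>i. odd (n i)"
    with x show ?thesis
      by blast
  qed
qed

text \<open>An odd \<open>n i\<close> is 1 or -1 mod 4, so \<open>x\<close> differs by an even
  vector from one with entries 1/2 or -1/2. Negation then adjusts the first sign.\<close>

lemma half_vector_mem:
  assumes sub: "int_submodule M" and L: "Lambda4 \<subseteq> M" and x: "x \<in> M"
    and n: "\<forall>i. odd (n i) \<and> x $ i = of_int (n i) / 2"
  obtains h where "h \<in> M" "h $ 1 = 1 / 2" "\<forall>i. h $ i = 1 / 2 \<or> h $ i = - 1 / 2"
proof -
  define g :: "real^4" where "g = (\<chi> i. if n i mod 4 = 1 then 1 / 2 else - 1 / 2)"
  have "\<exists>k::int. (x - g) $ i = 2 * of_int k" for i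
  proof (cases "n i mod 4 = 1")
    case True
    then obtain k where "n i = 4 * k + 1"
      by (metis mult_div_mod_eq)
    with True show ?thesis
      by (intro exI[of _ k]) (simp add: n g_def field_simps)
  next
    case False
    moreover have "odd (n i)"
      using n by blast
    ultimately have "n i mod 4 = 3"
      by presburger
    then obtain k where "n i = 4 * k + 3"
      by (metis mult_div_mod_eq)
    \<comment> \<open>Here \<open>n i\<close> is 4(k + 1) - 1 and \<open>g $ i\<close> is -1/2,
      hence the witness \<open>k + 1\<close>.\<close>
    with False show ?thesis
      by (intro exI[of _ "k + 1"]) (simp add: n g_def field_simps)
  qed
  then have "x - g \<in> M"
    using even_vector_mem[OF sub L] by blast
  with x have g: "g \<in> M"
    using int_module.subspace_diff[OF sub, of x "x - g"] by simp
  then have "- g \<in> M"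
    using int_module.subspace_diff[OF sub int_module.subspace_0[OF sub], of g] by simp
  show thesis
  proof (cases "g $ 1 = 1 / 2")
    case True
    with g show thesis
      by (intro that[of g]) (auto simp: g_def)
  next
    case False
    with \<open>- g \<in> M\<close> show thesis
      by (intro that[of "- g"]) (auto simp: g_def split: if_splits)
  qed
qed

text \<open>Both \<open>h\<close> and \<epsilon> 1 are unit vectors, so the reflection in their
  difference \<open>w\<close> exchanges them. It moves each generator of \<open>Lambda4\<close> by
  an integer multiple of 2w, which lies in \<open>M\<close>.\<close>

lemma intermediate_lattice_reflection:
  assumes sub: "int_submodule M"
    and int: "\<And>u v. u \<in> M \<Longrightarrow> v \<in> M \<Longrightarrow> u \<bullet> v \<in> \<int>"
    and L: "Lambda4 \<subseteq> M"
    and h: "h \<in> M" "h $ 1 = 1 / 2" "\<forall>i. h $ i = 1 / 2 \<or> h $ i = - 1 / 2"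
  shows "intermediate_lattice (reflection (h - \<epsilon> 1) ` M)"
proof
  define w where "w = h - \<epsilon> 1"
  \<comment> \<open>Subtracting \<epsilon> 1 only turns the first entry 1/2 into -1/2; hence
    \<open>w\<close> is again a unit vector.\<close>
  have w: "w $ i = 1 / 2 \<or> w $ i = - 1 / 2" for i
    using h(2) h(3)[rule_format, of i] by (cases "i = 1") (auto simp: w_def)
  have "w $ i * w $ i = 1 / 4" for i
  proof -
    have "(w $ i)\<^sup>2 = (1 / 2)\<^sup>2"
      using w[of i] unfolding power2_eq_iff by simp
    then show ?thesis
      by (simp add: power2_eq_square)
  qed
  then have "w \<bullet> w = (\<Sum>i\<in>(UNIV :: 4 set). 1 / 4)"
    unfolding inner_vec_def by (intro sum.cong) auto
  then have "w \<bullet> w = 1"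
    by simp
  then have refl: "reflection w x = x - (2 * (x \<bullet> w)) *\<^sub>R w" for x
    by (simp add: reflection_def)
  have "2 *\<^sub>R \<epsilon> 1 \<in> M"
    using double_\<epsilon>_mem[OF sub L] .
  then have w2: "2 *\<^sub>R w \<in> M"
    using int_module.subspace_diff[OF sub int_module.subspace_scale[OF sub h(1), of 2]]
    by (simp add: w_def algebra_simps)
  let ?M = "reflection w ` M"
  show sub': "int_submodule ?M"
    using sub linear_reflection int_submodule_linear_image by blast
  have "reflection w (2 *\<^sub>R \<epsilon> i) \<in> M" for i
  proof -
    \<comment> \<open>The inner product of 2\<epsilon> i with \<open>w\<close> is 1 or -1, according
      to the sign of \<open>w $ i\<close>.\<close>
    have "reflection w (2 *\<^sub>R \<epsilon> i) = 2 *\<^sub>R \<epsilon> i - int_scale (if w $ i = 1 / 2 then 1 else - 1) (2 *\<^sub>R w)"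
      using w[of i] by (auto simp: refl)
    then show ?thesis
      using double_\<epsilon>_mem[OF sub L] w2 int_module.subspace_diff[OF sub]
        int_module.subspace_scale[OF sub] by metis
  qed
  moreover have "reflection w (\<epsilon> 1 + \<epsilon> 2 + \<epsilon> 3 + \<epsilon> 4) \<in> M"
  proof -
    have "(\<epsilon> 1 + \<epsilon> 2 + \<epsilon> 3 + \<epsilon> 4) \<bullet> w = w $ 1 + w $ 2 + w $ 3 + w $ 4"
      by (simp add: inner_add_left)
    \<comment> \<open>A sum of four terms, each 1/2 or -1/2, is an integer.\<close>
    also have "\<dots> \<in> {-2, -1, 0, 1, 2}"
      using w[of 1] w[of 2] w[of 3] w[of 4] by auto
    finally obtain k :: int where "(\<epsilon> 1 + \<epsilon> 2 + \<epsilon> 3 + \<epsilon> 4) \<bullet> w = of_int k"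
      by (metis empty_iff insert_iff of_int_0 of_int_1 of_int_minus of_int_numeral)
    then have "reflection w (\<epsilon> 1 + \<epsilon> 2 + \<epsilon> 3 + \<epsilon> 4) = \<epsilon> 1 + \<epsilon> 2 + \<epsilon> 3 + \<epsilon> 4 - int_scale k (2 *\<^sub>R w)"
      by (simp add: refl mult.commute)
    then show ?thesis
      using L[unfolded Lambda4_subset_iff[OF sub]] w2 int_module.subspace_diff[OF sub]
        int_module.subspace_scale[OF sub] by metis
  qed
  ultimately show L': "Lambda4 \<subseteq> ?M"
    unfolding Lambda4_subset_iff[OF sub'] mem_reflection_image_iff by blast
  have int': "u \<bullet> v \<in> \<int>" if "u \<in> ?M" "v \<in> ?M" for u v
    using that int orthogonal_transformation_reflection[of w]
    by (auto simp: orthogonal_transformation_def)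
  have "w $ 1 = - 1 / 2"
    by (simp add: w_def h(2))
  then have "reflection w (\<epsilon> 1) = \<epsilon> 1 + w"
    by (simp add: refl)
  then have "reflection w (\<epsilon> 1) = h"
    by (simp add: w_def)
  with h(1) have \<epsilon>1: "\<epsilon> 1 \<in> ?M"
    by (simp add: mem_reflection_image_iff)
  show "?M \<subseteq> Z4"
  proof
    fix x assume x: "x \<in> ?M"
    \<comment> \<open>Pairing with \<epsilon> 1, now in the lattice, rules out the half-integral
      alternative.\<close>
    have "x $ 1 \<in> \<int>"
      using int'[OF x \<epsilon>1] by simp
    then obtain k :: int where k: "x $ 1 = of_int k"
      by (auto elim: Ints_cases)
    have "even m" if "x $ 1 = of_int m / 2" for m :: int
    proof -
      from that k have "real_of_int m = of_int (2 * k)"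
        by simp
      then have "m = 2 * k"
        by (simp only: of_int_eq_iff)
      then show ?thesis
        by simp
    qed
    then show "x \<in> Z4"
      using integer_or_half_integer[OF sub' int' L' x] by blast
  qed
qed

theorem theorem5p1:
  fixes M :: "(real^4) set"
  assumes "integral_lattice M"
    and "Lambda4 \<subseteq> M"
  shows "\<exists>N \<in> {Lambda4, adjoin Lambda4 {\<epsilon> 1}, adjoin Lambda4 {\<epsilon> 1, \<epsilon> 2}, A1_pow4, D4, Z4}.
           isometric_lattices M N"
proof -
  have int: "u \<bullet> v \<in> \<int>" if "u \<in> M" "v \<in> M" for u v
    using assms(1) that unfolding integral_lattice_def by blast
  have sub: "int_submodule M"
    using assms(1) int_submodule_int_span unfolding integral_lattice_def is_lattice_def by blast
  have "classified M"
  proof (cases "M \<subseteq> Z4")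
    case True
    then interpret intermediate_lattice M
      using sub assms(2) by unfold_locales
    show ?thesis
      by (rule is_classified)
  next
    case False
    then obtain x where x: "x \<in> M" "x \<notin> Z4"
      by blast
    obtain n :: "4 \<Rightarrow> int" where n: "\<forall>i. odd (n i) \<and> x $ i = of_int (n i) / 2"
      using integer_or_half_integer[OF sub int assms(2) x(1)] x(2) by blast
    then obtain h where h: "h \<in> M" "h $ 1 = 1 / 2" "\<forall>i. h $ i = 1 / 2 \<or> h $ i = - 1 / 2"
      by (rule half_vector_mem[OF sub assms(2) x(1)])
    \<comment> \<open>The reflected lattice is intermediate, and its classification pulls back to
      \<open>M\<close>.\<close>
    interpret intermediate_lattice "reflection (h - \<epsilon> 1) ` M"
      using intermediate_lattice_reflection[OF sub int assms(2) h] .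
    show ?thesis
      using is_classified classified_image orthogonal_transformation_reflection by blast
  qed
  then show ?thesis
    unfolding classified_def .
qed

end
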